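(* Let $f=\nu Z.(a\wedge \mathsf{X}^{>0}\mathsf{X}^{>0}Z)$ for an atomic proposition $a$ (a qualitative PμTL formula). Then there is no qualitative PCTL formula $g$ such that $[\![g]\!]_M=[\![f]\!]_M$ for every Markov chain $M$.
   Context: Fix a countable set $\mathcal{A}$ of atomic propositions and a countable set $\mathcal{Z}$ of variables. A Markov chain is $M=(S,\mathbf{T},L)$ with $S$ finite, $\mathbf{T}:S\times S\to[0,1]$ row-stochastic, $L:S\to2^{\mathcal{A}}$. A path is an infinite sequence $s_0s_1\dots$ with $\mathbf{T}(s_i,s_{i+1})>0$; from a state $s$ there is the standard probability measure $\Pr_{M,s}$ on paths starting in $s$, with $\Pr_{M,s}(\text{paths with prefix }s_0\dots s_n)=\prod_{i<n}\mathbf{T}(s_i,s_{i+1})$ if $s_0=s$. PμTL formulas: $f::=\top\mid\bot\mid a\mid\neg a\mid Z\mid \mathsf{X}^{\sim p}f\mid f\wedge f\mid f\vee f\mid \mu Z.f\mid \nu Z.f$ (${\sim}\in\{>,\geq\}$, $p\in[0,1]$), with semantics under an assignment $e:\mathcal{Z}\to2^S$: $[\![\top]\!]=S$, $[\![\bot]\!]=\emptyset$, $[\![a]\!]=\{s:a\in L(s)\}$, $[\![\neg a]\!]=\{s:a\notin L(s)\}$, $[\![Z]\!]=e(Z)$, $[\![\mathsf{X}^{\sim p}f]\!]=\{s:\sum_{s'\in[\![f]\!]}\mathbf{T}(s,s')\sim p\}$, $\wedge,\vee$ as $\cap,\cup$, $\mu Z.f$ the least and $\nu Z.f$ the greatest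 fixpoint of $S'\mapsto[\![f]\!]_M(e[Z\mapsto S'])$. For closed formulas write $[\![f]\!]_M$. PCTL formulas: $g::=\top\mid\bot\mid a\mid\neg a\mid \mathsf{X}^{\sim p}g\mid g\wedge g\mid g\vee g\mid g\,\mathsf{U}^{\sim p}g\mid g\,\mathsf{R}^{\sim p}g$, with the same clauses for $\top,\bot,a,\neg a,\mathsf{X},\wedge,\vee$, and $[\![g_1\mathsf{U}^{\sim p}g_2]\!]_M=\{s:\Pr_{M,s}\{\pi:\pi\models g_1\mathsf{U}g_2\}\sim p\}$, $[\![g_1\mathsf{R}^{\sim p}g_2]\!]_M=\{s:\Pr_{M,s}\{\pi:\pi\models g_1\mathsf{R}g_2\}\sim p\}$, where for $\pi=s_0s_1\dots$: $\pi\models g_1\mathsf{U}g_2$ iff some $i$ has $s_i\in[\![g_2]\!]$ and $s_j\in[\![g_1]\!]$ for all $j<i$; $\pi\models g_1\mathsf{R}g_2$ iff $\pi\models g_2\mathsf{U}(g_1\wedge g_2)$ or $s_j\in[\![g_2]\!]$ for all $j$. A formula is qualitative if every probability threshold $p$ occurring in it is $0$ or $1$. *)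

theory Defs
  imports "HOL-Probability.Probability"
begin

text \<open>The transition function is meaningful on \<^term>\<open>states M \<times> states M\<close> and the labelling on
  \<^term>\<open>states M\<close> only; all semantic definitions below are confined to \<^term>\<open>states M\<close>. State sets
  are finite, so chains with state type \<^typ>\<open>nat\<close> represent all chains up to renaming of states.\<close>

record ('s, 'ap) chain =
  states :: "'s set"
  tprob :: "'s \<Rightarrow> 's \<Rightarrow> real"
  label :: "'s \<Rightarrow> 'ap set"

locale markov_chain =
  fixes M :: "('s, 'ap) chain"
  assumes finite_states: "finite (states M)"
    and tprob_nonneg: "\<And>s t. s \<in> states M \<Longrightarrow> t \<in> states M \<Longrightarrow> 0 \<le> tprob M s t"
    and tprob_le_1: "\<And>s t. s \<in> states M \<Longrightarrow> t \<in> states M \<Longrightarrow> tprob M s t \<le> 1"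
    and tprob_sum: "\<And>s. s \<in> states M \<Longrightarrow> (\<Sum>t\<in>states M. tprob M s t) = 1"

definition paths_from :: "('s, 'ap) chain \<Rightarrow> 's \<Rightarrow> (nat \<Rightarrow> 's) set" where
  "paths_from M s =
     {\<pi>. \<pi> 0 = s \<and> (\<forall>i. \<pi> i \<in> states M) \<and> (\<forall>i. 0 < tprob M (\<pi> i) (\<pi> (Suc i)))}"

text \<open>The path measure lives on the product sigma-algebra over all sequences of states and is the
  Ionescu-Tulcea limit of the following kernels: position \<open>0\<close> is \<open>s\<close>, and position \<open>Suc i\<close> is drawn
  from the row of the state at position \<open>i\<close>. Lemma \<open>path_measure_cylinder\<close> below gives the usual
  characterization on cylinders, and \<open>AE_paths_from\<close> says that it is concentrated on the paths.\<close>

definition step_kernel :: "('s, 'ap) chain \<Rightarrow> 's \<Rightarrow> nat \<Rightarrow> (nat \<Rightarrow> 's) \<Rightarrow> 's measure" where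
  "step_kernel M s i \<omega> =
     (case i of
        0 \<Rightarrow> return (count_space (states M)) s
      | Suc j \<Rightarrow> point_measure (states M) (\<lambda>t. ennreal (tprob M (\<omega> j) t)))"

definition path_measure :: "('s, 'ap) chain \<Rightarrow> 's \<Rightarrow> (nat \<Rightarrow> 's) measure" where
  "path_measure M s =
     projective_family.lim UNIV
       (Ionescu_Tulcea.CI (step_kernel M s) (\<lambda>_. count_space (states M)))
       (\<lambda>_. count_space (states M))"

definition path_prob :: "('s, 'ap) chain \<Rightarrow> 's \<Rightarrow> ((nat \<Rightarrow> 's) \<Rightarrow> bool) \<Rightarrow> real" where
  "path_prob M s \<phi> = measure (path_measure M s) {\<pi> \<in> paths_from M s. \<phi> \<pi>}"

definition path_until :: "'s set \<Rightarrow> 's set \<Rightarrow> (nat \<Rightarrow> 's) \<Rightarrow> bool" where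
  "path_until A B \<pi> \<longleftrightarrow> (\<exists>i. \<pi> i \<in> B \<and> (\<forall>j<i. \<pi> j \<in> A))"

definition path_release :: "'s set \<Rightarrow> 's set \<Rightarrow> (nat \<Rightarrow> 's) \<Rightarrow> bool" where
  "path_release A B \<pi> \<longleftrightarrow> path_until B (A \<inter> B) \<pi> \<or> (\<forall>j. \<pi> j \<in> B)"

datatype cmp = Greater | GreaterEq

fun cmp_holds :: "cmp \<Rightarrow> real \<Rightarrow> real \<Rightarrow> bool" where
  "cmp_holds Greater x p \<longleftrightarrow> x > p"
| "cmp_holds GreaterEq x p \<longleftrightarrow> x \<ge> p"

text \<open>Thresholds are arbitrary reals here; membership in the unit interval is implied by the
  predicates for qualitative formulas.\<close>

datatype ('ap, 'z) pmutl =
    MTop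
  | MBot
  | MAtom 'ap
  | MNegAtom 'ap
  | MVar 'z
  | MNext cmp real "('ap, 'z) pmutl"
  | MAnd "('ap, 'z) pmutl" "('ap, 'z) pmutl"
  | MOr "('ap, 'z) pmutl" "('ap, 'z) pmutl"
  | MMu 'z "('ap, 'z) pmutl"
  | MNu 'z "('ap, 'z) pmutl"

datatype 'ap pctl =
    CTop
  | CBot
  | CAtom 'ap
  | CNegAtom 'ap
  | CNext cmp real "'ap pctl"
  | CAnd "'ap pctl" "'ap pctl"
  | COr "'ap pctl" "'ap pctl"
  | CUntil "'ap pctl" cmp real "'ap pctl"
  | CRelease "'ap pctl" cmp real "'ap pctl"

fun pmutl_qualitative :: "('ap, 'z) pmutl \<Rightarrow> bool" where
  "pmutl_qualitative (MNext c p f) \<longleftrightarrow> p \<in> {0, 1} \<and> pmutl_qualitative f"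
| "pmutl_qualitative (MAnd f g) \<longleftrightarrow> pmutl_qualitative f \<and> pmutl_qualitative g"
| "pmutl_qualitative (MOr f g) \<longleftrightarrow> pmutl_qualitative f \<and> pmutl_qualitative g"
| "pmutl_qualitative (MMu Z f) \<longleftrightarrow> pmutl_qualitative f"
| "pmutl_qualitative (MNu Z f) \<longleftrightarrow> pmutl_qualitative f"
| "pmutl_qualitative _ \<longleftrightarrow> True"

fun pctl_qualitative :: "'ap pctl \<Rightarrow> bool" where
  "pctl_qualitative (CNext c p g) \<longleftrightarrow> p \<in> {0, 1} \<and> pctl_qualitative g"
| "pctl_qualitative (CAnd g h) \<longleftrightarrow> pctl_qualitative g \<and> pctl_qualitative h"
| "pctl_qualitative (COr g h) \<longleftrightarrow> pctl_qualitative g \<and> pctl_qualitative h"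
| "pctl_qualitative (CUntil g c p h) \<longleftrightarrow> p \<in> {0, 1} \<and> pctl_qualitative g \<and> pctl_qualitative h"
| "pctl_qualitative (CRelease g c p h) \<longleftrightarrow> p \<in> {0, 1} \<and> pctl_qualitative g \<and> pctl_qualitative h"
| "pctl_qualitative _ \<longleftrightarrow> True"

fun free_vars :: "('ap, 'z) pmutl \<Rightarrow> 'z set" where
  "free_vars (MVar Z) = {Z}"
| "free_vars (MNext c p f) = free_vars f"
| "free_vars (MAnd f g) = free_vars f \<union> free_vars g"
| "free_vars (MOr f g) = free_vars f \<union> free_vars g"
| "free_vars (MMu Z f) = free_vars f - {Z}"
| "free_vars (MNu Z f) = free_vars f - {Z}"
| "free_vars _ = {}"

definition next_sem :: "('s, 'ap) chain \<Rightarrow> cmp \<Rightarrow> real \<Rightarrow> 's set \<Rightarrow> 's set" where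
  "next_sem M c p A = {s \<in> states M. cmp_holds c (\<Sum>t\<in>A. tprob M s t) p}"

text \<open>Intersecting with \<^term>\<open>states M\<close> in the variable case has no effect on assignments of subsets
  of \<^term>\<open>states M\<close>. It makes every denotation a subset of \<^term>\<open>states M\<close>, so that \<^const>\<open>lfp\<close> and
  \<^const>\<open>gfp\<close>, which range over all sets of the type, are the least and greatest fixpoints
  among the subsets of \<^term>\<open>states M\<close>; see \<open>pmutl_sem_Mu\<close> and \<open>pmutl_sem_Nu\<close> below.\<close>

fun pmutl_sem :: "('s, 'ap) chain \<Rightarrow> ('ap, 'z) pmutl \<Rightarrow> ('z \<Rightarrow> 's set) \<Rightarrow> 's set" where
  "pmutl_sem M MTop e = states M"
| "pmutl_sem M MBot e = {}"
| "pmutl_sem M (MAtom a) e = {s \<in> states M. a \<in> label M s}"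
| "pmutl_sem M (MNegAtom a) e = {s \<in> states M. a \<notin> label M s}"
| "pmutl_sem M (MVar Z) e = e Z \<inter> states M"
| "pmutl_sem M (MNext c p f) e = next_sem M c p (pmutl_sem M f e)"
| "pmutl_sem M (MAnd f g) e = pmutl_sem M f e \<inter> pmutl_sem M g e"
| "pmutl_sem M (MOr f g) e = pmutl_sem M f e \<union> pmutl_sem M g e"
| "pmutl_sem M (MMu Z f) e = lfp (\<lambda>X. pmutl_sem M f (e(Z := X)))"
| "pmutl_sem M (MNu Z f) e = gfp (\<lambda>X. pmutl_sem M f (e(Z := X)))"

text \<open>For closed formulas the assignment is irrelevant (\<open>pmutl_sem_closed\<close> below).\<close>

definition pmutl_closed_sem :: "('s, 'ap) chain \<Rightarrow> ('ap, 'z) pmutl \<Rightarrow> 's set" where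
  "pmutl_closed_sem M f = pmutl_sem M f (\<lambda>_. {})"

fun pctl_sem :: "('s, 'ap) chain \<Rightarrow> 'ap pctl \<Rightarrow> 's set" where
  "pctl_sem M CTop = states M"
| "pctl_sem M CBot = {}"
| "pctl_sem M (CAtom a) = {s \<in> states M. a \<in> label M s}"
| "pctl_sem M (CNegAtom a) = {s \<in> states M. a \<notin> label M s}"
| "pctl_sem M (CNext c p g) = next_sem M c p (pctl_sem M g)"
| "pctl_sem M (CAnd g h) = pctl_sem M g \<inter> pctl_sem M h"
| "pctl_sem M (COr g h) = pctl_sem M g \<union> pctl_sem M h"
| "pctl_sem M (CUntil g c p h) =
     {s \<in> states M. cmp_holds c (path_prob M s (path_until (pctl_sem M g) (pctl_sem M h))) p}"
| "pctl_sem M (CRelease g c p h) =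
     {s \<in> states M. cmp_holds c (path_prob M s (path_release (pctl_sem M g) (pctl_sem M h))) p}"

lemma pmutl_sem_cong:
  "(\<And>Z. Z \<in> free_vars f \<Longrightarrow> e Z = e' Z) \<Longrightarrow> pmutl_sem M f e = pmutl_sem M f e'"
proof (induction f arbitrary: e e')
  case (MMu Z f)
  have "pmutl_sem M f (e(Z := X)) = pmutl_sem M f (e'(Z := X))" for X
    by (rule MMu.IH) (use MMu.prems in auto)
  then show ?case by simp
next
  case (MNu Z f)
  have "pmutl_sem M f (e(Z := X)) = pmutl_sem M f (e'(Z := X))" for X
    by (rule MNu.IH) (use MNu.prems in auto)
  then show ?case by simp
next
  case (MNext c p f)
  have "pmutl_sem M f e = pmutl_sem M f e'"
    by (rule MNext.IH) (use MNext.prems in auto)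
  then show ?case by simp
next
  case (MAnd f g)
  have "pmutl_sem M f e = pmutl_sem M f e'" "pmutl_sem M g e = pmutl_sem M g e'"
    by (rule MAnd.IH; use MAnd.prems in auto)+
  then show ?case by simp
next
  case (MOr f g)
  have "pmutl_sem M f e = pmutl_sem M f e'" "pmutl_sem M g e = pmutl_sem M g e'"
    by (rule MOr.IH; use MOr.prems in auto)+
  then show ?case by simp
qed auto

lemma pmutl_sem_closed: "free_vars f = {} \<Longrightarrow> pmutl_sem M f e = pmutl_closed_sem M f"
  unfolding pmutl_closed_sem_def by (rule pmutl_sem_cong) simp

context markov_chain
begin

lemma next_sem_mono:
  assumes "A \<subseteq> B" "B \<subseteq> states M"
  shows "next_sem M c p A \<subseteq> next_sem M c p B"
proof
  fix s assume s: "s \<in> next_sem M c p A"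
  have "(\<Sum>t\<in>A. tprob M s t) \<le> (\<Sum>t\<in>B. tprob M s t)"
    using assms s finite_subset[OF assms(2) finite_states]
    by (intro sum_mono2) (auto simp: next_sem_def intro: tprob_nonneg)
  then show "s \<in> next_sem M c p B"
    using s by (cases c) (auto simp: next_sem_def)
qed

lemma pmutl_sem_subset: "pmutl_sem M f e \<subseteq> states M"
proof (induction f arbitrary: e)
  case (MMu Z f)
  have "lfp (\<lambda>X. pmutl_sem M f (e(Z := X))) \<subseteq> states M"
    by (rule lfp_lowerbound) (rule MMu)
  then show ?case by simp
next
  case (MNu Z f)
  have "gfp (\<lambda>X. pmutl_sem M f (e(Z := X))) \<subseteq> states M"
    by (rule gfp_least) (rule order_trans[OF _ MNu])
  then show ?case by simp
next
  case (MAnd f g)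
  then show ?case by (simp add: le_infI1)
qed (auto simp: next_sem_def)

lemma pmutl_sem_mono: "(\<And>Z. e Z \<subseteq> e' Z) \<Longrightarrow> pmutl_sem M f e \<subseteq> pmutl_sem M f e'"
proof (induction f arbitrary: e e')
  case (MNext c p f)
  then show ?case by (simp add: next_sem_mono pmutl_sem_subset)
next
  case (MMu Z f)
  have "pmutl_sem M f (e(Z := X)) \<subseteq> pmutl_sem M f (e'(Z := X))" for X
    by (rule MMu.IH) (use MMu.prems in auto)
  then show ?case by (auto intro!: lfp_mono del: subsetI)
next
  case (MNu Z f)
  have "pmutl_sem M f (e(Z := X)) \<subseteq> pmutl_sem M f (e'(Z := X))" for X
    by (rule MNu.IH) (use MNu.prems in auto)
  then show ?case by (auto intro!: gfp_mono del: subsetI)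
next
  case (MAnd f g)
  have "pmutl_sem M f e \<subseteq> pmutl_sem M f e'" "pmutl_sem M g e \<subseteq> pmutl_sem M g e'"
    using MAnd by blast+
  then show ?case by auto
next
  case (MOr f g)
  have "pmutl_sem M f e \<subseteq> pmutl_sem M f e'" "pmutl_sem M g e \<subseteq> pmutl_sem M g e'"
    using MOr by blast+
  then show ?case by auto
qed auto

lemma mono_pmutl_sem: "mono (\<lambda>X. pmutl_sem M f (e(Z := X)))"
  by (rule monoI, rule pmutl_sem_mono) auto

lemma pmutl_sem_Mu:
  shows "pmutl_sem M (MMu Z f) e \<subseteq> states M"
    and "pmutl_sem M f (e(Z := pmutl_sem M (MMu Z f) e)) = pmutl_sem M (MMu Z f) e"
    and "\<And>X. pmutl_sem M f (e(Z := X)) = X \<Longrightarrow> pmutl_sem M (MMu Z f) e \<subseteq> X"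
proof -
  show "pmutl_sem M (MMu Z f) e \<subseteq> states M"
    by (rule pmutl_sem_subset)
  show "pmutl_sem M f (e(Z := pmutl_sem M (MMu Z f) e)) = pmutl_sem M (MMu Z f) e"
    using lfp_unfold[OF mono_pmutl_sem[of f e Z]] by simp
  show "pmutl_sem M (MMu Z f) e \<subseteq> X" if "pmutl_sem M f (e(Z := X)) = X" for X
    using lfp_lowerbound[of "\<lambda>X. pmutl_sem M f (e(Z := X))" X] that by simp
qed

lemma pmutl_sem_Nu:
  shows "pmutl_sem M (MNu Z f) e \<subseteq> states M"
    and "pmutl_sem M f (e(Z := pmutl_sem M (MNu Z f) e)) = pmutl_sem M (MNu Z f) e"
    and "\<And>X. pmutl_sem M f (e(Z := X)) = X \<Longrightarrow> X \<subseteq> pmutl_sem M (MNu Z f) e"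
proof -
  show "pmutl_sem M (MNu Z f) e \<subseteq> states M"
    by (rule pmutl_sem_subset)
  show "pmutl_sem M f (e(Z := pmutl_sem M (MNu Z f) e)) = pmutl_sem M (MNu Z f) e"
    using gfp_unfold[OF mono_pmutl_sem[of f e Z]] by simp
  show "X \<subseteq> pmutl_sem M (MNu Z f) e" if "pmutl_sem M f (e(Z := X)) = X" for X
    using gfp_upperbound[of X "\<lambda>X. pmutl_sem M f (e(Z := X))"] that by simp
qed

context
  fixes s assumes s: "s \<in> states M"
begin

lemma prob_space_step:
  assumes "t \<in> states M"
  shows "prob_space (point_measure (states M) (\<lambda>u. ennreal (tprob M t u)))"
proof (rule prob_spaceI)
  have "(\<Sum>u\<in>states M. ennreal (tprob M t u)) = ennreal (\<Sum>u\<in>states M. tprob M t u)"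
    by (rule sum_ennreal) (use assms tprob_nonneg in auto)
  then show "emeasure (point_measure (states M) (\<lambda>u. ennreal (tprob M t u)))
      (space (point_measure (states M) (\<lambda>u. ennreal (tprob M t u)))) = 1"
    by (simp add: space_point_measure emeasure_point_measure_finite[OF finite_states] tprob_sum assms)
qed

lemma Ionescu_Tulcea_step_kernel:
  "Ionescu_Tulcea (step_kernel M s) (\<lambda>_. count_space (states M))"
proof (rule Ionescu_Tulcea.intro)
  fix i
  show "step_kernel M s i \<in> measurable (PiM {0..<i} (\<lambda>_. count_space (states M)))
          (subprob_algebra (count_space (states M)))"
  proof (cases i)
    case 0
    have "return (count_space (states M)) s \<in> space (subprob_algebra (count_space (states M)))"
      by (simp add: space_subprob_algebra s prob_space_return
          prob_space_imp_subprob_space)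
    then show ?thesis
      unfolding 0 step_kernel_def by simp
  next
    case (Suc j)
    have [measurable]: "(\<lambda>\<omega>. \<omega> j) \<in> measurable (PiM {0..<i} (\<lambda>_. count_space (states M))) (count_space (states M))"
      using Suc by (intro measurable_component_singleton) auto
    have "(\<lambda>t. point_measure (states M) (\<lambda>u. ennreal (tprob M t u)))
        \<in> measurable (count_space (states M)) (subprob_algebra (count_space (states M)))"
      by (auto simp: space_subprob_algebra sets_point_measure_count_space
          prob_space_imp_subprob_space prob_space_step)
    then have "(\<lambda>\<omega>. point_measure (states M) (\<lambda>u. ennreal (tprob M (\<omega> j) u))) \<in>
      measurable (PiM {0..<i} (\<lambda>_. count_space (states M))) (subprob_algebra (count_space (states M)))"
      by (rule measurable_compose[rotated]) measurable
    then show ?thesis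
      unfolding Suc step_kernel_def by simp
  qed
next
  fix i and x :: "nat \<Rightarrow> 's"
  assume "x \<in> space (PiM {0..<i} (\<lambda>_. count_space (states M)))"
  then show "prob_space (step_kernel M s i x)"
    by (cases i) (auto simp: step_kernel_def s prob_space_return prob_space_step space_PiM PiE_iff)
qed

interpretation IT: Ionescu_Tulcea "step_kernel M s" "\<lambda>_. count_space (states M)"
  by (rule Ionescu_Tulcea_step_kernel)

lemma path_measure_eq_lim: "path_measure M s = IT.PF.lim"
  by (simp add: path_measure_def)

lemma space_path_measure: "space (path_measure M s) = UNIV \<rightarrow> states M"
  by (simp add: path_measure_eq_lim space_PiM PiE_UNIV_domain Pi_def)

lemma sets_path_measure:
  "sets (path_measure M s) = sets (PiM UNIV (\<lambda>_. count_space (states M)))"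
  by (simp add: path_measure_eq_lim)

lemma emeasure_C_cylinder:
  assumes x: "\<And>i. i \<le> n \<Longrightarrow> x i \<in> states M"
  shows "emeasure (IT.C 0 (Suc n) (\<lambda>_. undefined)) (PiE {0..<Suc n} (\<lambda>i. {x i})) =
    (if x 0 = s then \<Prod>i<n. ennreal (tprob M (x i) (x (Suc i))) else 0)"
  using x
proof (induction n)
  case 0
  have "IT.C 0 (Suc 0) (\<lambda>_. undefined) =
      return (PiM {0..<0} (\<lambda>_. count_space (states M))) (\<lambda>_. undefined) \<bind> IT.eP 0"
    by simp
  also have "\<dots> = IT.eP 0 (\<lambda>_. undefined)"
    by (rule bind_return[OF IT.measurable_eP]) (simp add: space_PiM)
  finally have "IT.C 0 (Suc 0) (\<lambda>_. undefined) = IT.eP 0 (\<lambda>_. undefined)" .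
  moreover have x0: "x 0 \<in> states M" using 0 by simp
  moreover have "(\<lambda>y. (\<lambda>_. undefined)(0 := y)) -` PiE {0..<Suc 0} (\<lambda>i. {x i}) \<inter> states M = {x 0}"
  proof -
    have "(\<lambda>_. undefined)(0 := y) \<in> PiE {0..<Suc 0} (\<lambda>i. {x i}) \<longleftrightarrow> y = x 0" for y
      by (simp add: PiE_iff)
    then show ?thesis using x0 by auto
  qed
  moreover have "PiE {0..<Suc 0} (\<lambda>i. {x i}) \<in> sets (PiM {0..<Suc 0} (\<lambda>_. count_space (states M)))"
    using 0 by (intro sets_PiM_I_finite) auto
  ultimately have "emeasure (IT.C 0 (Suc 0) (\<lambda>_. undefined)) (PiE {0..<Suc 0} (\<lambda>i. {x i})) =
      emeasure (step_kernel M s 0 (\<lambda>_. undefined)) {x 0}"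
    using IT.emeasure_eP[of "\<lambda>_. undefined" 0 "PiE {0..<Suc 0} (\<lambda>i. {x i})"]
    by (simp only: space_count_space) (simp add: space_PiM)
  also have "\<dots> = (if x 0 = s then 1 else 0)"
    using 0 by (simp add: step_kernel_def)
  finally show ?case by simp
next
  case (Suc n)
  let ?X = "\<lambda>n. PiE {0..<Suc n} (\<lambda>i. {x i})"
  let ?C = "IT.C 0 (Suc n) (\<lambda>_. undefined)"
  let ?t = "ennreal (tprob M (x n) (x (Suc n)))"
  have sets_X: "?X m \<in> sets (PiM {0..<Suc m} (\<lambda>_. count_space (states M)))" if "m \<le> Suc n" for m
    using that Suc.prems by (intro sets_PiM_I_finite) auto
  have space_C: "space ?C = space (PiM {0..<Suc n} (\<lambda>_. count_space (states M)))"
    using IT.space_C[of "\<lambda>_. undefined" 0 "Suc n"] by (simp add: space_PiM)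
  have sets_C: "sets ?C = sets (PiM {0..<Suc n} (\<lambda>_. count_space (states M)))"
    using IT.sets_C[of "\<lambda>_. undefined" 0 "Suc n"] by (simp add: space_PiM)
  have step: "emeasure (IT.eP (Suc n) \<omega>) (?X (Suc n)) = ?t * indicator (?X n) \<omega>"
    if \<omega>: "\<omega> \<in> space (PiM {0..<Suc n} (\<lambda>_. count_space (states M)))" for \<omega>
  proof -
    have "fun_upd \<omega> (Suc n) -` ?X (Suc n) \<inter> states M = (if \<omega> \<in> ?X n then {x (Suc n)} else {})"
    proof -
      have "fun_upd \<omega> (Suc n) y \<in> ?X (Suc n) \<longleftrightarrow> \<omega> \<in> ?X n \<and> y = x (Suc n)" for y
        using \<omega> by (auto simp: space_PiM PiE_iff extensional_def less_Suc_eq)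
      then show ?thesis using Suc.prems by auto
    qed
    moreover have "\<omega> \<in> ?X n \<Longrightarrow> \<omega> n = x n" by (auto simp: PiE_iff)
    ultimately show ?thesis
      using Suc.prems \<omega> sets_X[of "Suc n"]
      by (auto simp: IT.emeasure_eP step_kernel_def emeasure_point_measure_finite[OF finite_states])
  qed
  have "emeasure (IT.C 0 (Suc (Suc n)) (\<lambda>_. undefined)) (?X (Suc n)) =
      emeasure (?C \<bind> IT.eP (Suc n)) (?X (Suc n))"
    by simp
  also have "\<dots> = (\<integral>\<^sup>+\<omega>. emeasure (IT.eP (Suc n) \<omega>) (?X (Suc n)) \<partial>?C)"
  proof (rule emeasure_bind)
    show "space ?C \<noteq> {}" using space_C IT.non_empty by (auto simp: space_PiM_empty_iff)
    show "IT.eP (Suc n) \<in> measurable ?C (subprob_algebra (PiM {0..<Suc (Suc n)} (\<lambda>_. count_space (states M))))"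
      using IT.measurable_eP[of "Suc n"] by (simp only: measurable_cong_sets[OF sets_C refl])
    show "?X (Suc n) \<in> sets (PiM {0..<Suc (Suc n)} (\<lambda>_. count_space (states M)))"
      by (rule sets_X) simp
  qed
  also have "\<dots> = (\<integral>\<^sup>+\<omega>. ?t * indicator (?X n) \<omega> \<partial>?C)"
    by (rule nn_integral_cong) (simp only: space_C step)
  also have "\<dots> = ?t * emeasure ?C (?X n)"
    using sets_X[of n] sets_C by (intro nn_integral_cmult_indicator) auto
  finally show ?case
    using Suc by (simp add: mult.commute)
qed

lemma prob_space_path_measure: "prob_space (path_measure M s)"
proof (rule prob_spaceI)
  let ?X = "{\<lambda>_. undefined} :: (nat \<Rightarrow> 's) set"
  interpret CI: prob_space "IT.CI {}" by (rule IT.PF.prob_space_P) auto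
  have sp: "space (IT.CI {}) = ?X"
    by (simp add: IT.CI_def space_PiM)
  have "emeasure IT.PF.lim (IT.PF.emb UNIV {} ?X) = emeasure (IT.CI {}) ?X"
    by (rule IT.lim) (simp_all add: PiM_empty)
  also have "\<dots> = 1"
    using CI.emeasure_space_1 sp by simp
  also have "IT.PF.emb UNIV {} ?X = space (path_measure M s)"
    by (auto simp: prod_emb_def path_measure_eq_lim space_PiM)
  finally show "emeasure (path_measure M s) (space (path_measure M s)) = 1"
    by (simp add: path_measure_eq_lim)
qed

theorem path_measure_cylinder:
  assumes x: "\<And>i. i \<le> n \<Longrightarrow> x i \<in> states M"
  shows "measure (path_measure M s) {\<pi> \<in> UNIV \<rightarrow> states M. \<forall>i\<le>n. \<pi> i = x i} =
    (if x 0 = s then \<Prod>i<n. tprob M (x i) (x (Suc i)) else 0)"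
proof -
  let ?X = "PiE {0..<Suc n} (\<lambda>i. {x i})"
  have X: "?X \<in> sets (PiM {0..<Suc n} (\<lambda>_. count_space (states M)))"
    using x by (intro sets_PiM_I_finite) auto
  have "{\<pi> \<in> UNIV \<rightarrow> states M. \<forall>i\<le>n. \<pi> i = x i} = IT.PF.emb UNIV {0..<Suc n} ?X"
    by (auto simp: prod_emb_def space_PiM PiE_iff Pi_iff restrict_def extensional_def less_Suc_eq_le)
  then have "emeasure (path_measure M s) {\<pi> \<in> UNIV \<rightarrow> states M. \<forall>i\<le>n. \<pi> i = x i} =
      emeasure (IT.C 0 (Suc n) (\<lambda>_. undefined)) ?X"
    unfolding path_measure_eq_lim using IT.lim[OF _ X] IT.emeasure_CI[OF _ X, of "Suc n"] X
    by (simp add: prod_emb_id[OF sets.sets_into_space[OF X, unfolded space_PiM], simplified])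
  also have "\<dots> = (if x 0 = s then \<Prod>i<n. ennreal (tprob M (x i) (x (Suc i))) else 0)"
    using x by (rule emeasure_C_cylinder)
  also have "\<dots> = ennreal (if x 0 = s then \<Prod>i<n. tprob M (x i) (x (Suc i)) else 0)"
    using x by (auto intro!: prod_ennreal tprob_nonneg)
  finally show ?thesis
    using x by (subst measure_def) (auto intro!: enn2real_ennreal prod_nonneg tprob_nonneg)
qed

lemma pred_component:
  "Measurable.pred (path_measure M s) (\<lambda>\<pi>. P (\<pi> i))"
proof -
  have "(\<lambda>\<pi>. \<pi> i) \<in> measurable (PiM UNIV (\<lambda>_. count_space (states M))) (count_space (states M))"
    by (rule measurable_component_singleton) simp
  then have "(\<lambda>\<pi>. \<pi> i) \<in> measurable (path_measure M s) (count_space (states M))"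
    by (simp only: measurable_cong_sets[OF sets_path_measure refl])
  then show ?thesis
    by (rule measurable_compose) simp
qed

lemma paths_from_eq:
  "paths_from M s = {\<pi> \<in> space (path_measure M s). \<pi> 0 = s \<and>
     (\<forall>i. \<exists>u\<in>states M. \<exists>v\<in>states M. \<pi> i = u \<and> \<pi> (Suc i) = v \<and> 0 < tprob M u v)}"
  by (auto simp: paths_from_def space_path_measure Pi_iff)

lemma sets_path_event:
  assumes "Measurable.pred (path_measure M s) \<phi>"
  shows "{\<pi> \<in> paths_from M s. \<phi> \<pi>} \<in> sets (path_measure M s)"
proof -
  have "Measurable.pred (path_measure M s) (\<lambda>\<pi>. (\<pi> 0 = s \<and>
     (\<forall>i. \<exists>u\<in>states M. \<exists>v\<in>states M. \<pi> i = u \<and> \<pi> (Suc i) = v \<and> 0 < tprob M u v)) \<and> \<phi> \<pi>)"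
    by (intro pred_intros_logic pred_intros_countable pred_intros_finite finite_states assms
        pred_component measurable_const) auto
  then show ?thesis
    unfolding paths_from_eq by (simp add: pred_def conj_assoc)
qed

lemma pred_path_until: "Measurable.pred (path_measure M s) (path_until A B)"
  unfolding path_until_def[abs_def]
  by (intro pred_intros_logic pred_intros_countable pred_component)

lemma pred_path_release: "Measurable.pred (path_measure M s) (path_release A B)"
  unfolding path_release_def[abs_def]
  by (intro pred_intros_logic pred_intros_countable pred_component pred_path_until)

theorem AE_paths_from: "AE \<pi> in path_measure M s. \<pi> \<in> paths_from M s"
proof -
  let ?N = "path_measure M s"
  interpret N: prob_space ?N by (rule prob_space_path_measure)
  let ?cyl = "\<lambda>n x. {\<pi> \<in> UNIV \<rightarrow> states M. \<forall>i\<le>n. \<pi> i = x i}"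
  have sets_cyl: "?cyl n x \<in> sets ?N" for n x
  proof -
    have "Measurable.pred ?N (\<lambda>\<pi>. \<forall>i\<in>{..n}. \<pi> i = x i)"
      by (intro pred_intros_finite pred_component) auto
    moreover have "?cyl n x = {\<pi> \<in> space ?N. \<forall>i\<in>{..n}. \<pi> i = x i}"
      unfolding space_path_measure atMost_iff Ball_def by (rule refl)
    ultimately show ?thesis
      unfolding pred_def by (simp only:)
  qed
  have null: "?cyl n x \<in> null_sets ?N"
    if "\<And>i. i \<le> n \<Longrightarrow> x i \<in> states M" "x 0 \<noteq> s \<or> (\<exists>i<n. tprob M (x i) (x (Suc i)) = 0)" for n x
  proof -
    have "measure ?N (?cyl n x) = 0"
      using path_measure_cylinder[of n x] that by auto
    then show ?thesis
      by (intro null_setsI sets_cyl) (simp only: N.emeasure_eq_measure ennreal_0)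
  qed
  have 1: "AE \<pi> in ?N. \<pi> 0 = s"
  proof (rule AE_I')
    show "(\<Union>u\<in>states M - {s}. ?cyl 0 (\<lambda>_. u)) \<in> null_sets ?N"
      using finite_states by (intro null_sets_UN' null) (auto intro: countable_finite)
    show "{\<pi> \<in> space ?N. \<pi> 0 \<noteq> s} \<subseteq> (\<Union>u\<in>states M - {s}. ?cyl 0 (\<lambda>_. u))"
      by (auto simp: space_path_measure)
  qed
  have 2: "AE \<pi> in ?N. 0 < tprob M (\<pi> i) (\<pi> (Suc i))" for i
  proof (rule AE_I')
    let ?I = "{x \<in> {..Suc i} \<rightarrow>\<^sub>E states M. tprob M (x i) (x (Suc i)) = 0}"
    have "finite ?I"
      using finite_PiE[of "{..Suc i}" "\<lambda>_. states M"] finite_states by auto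
    then show "(\<Union>x\<in>?I. ?cyl (Suc i) x) \<in> null_sets ?N"
      by (intro null_sets_UN' null) (auto intro: countable_finite)
    show "{\<pi> \<in> space ?N. \<not> 0 < tprob M (\<pi> i) (\<pi> (Suc i))} \<subseteq> (\<Union>x\<in>?I. ?cyl (Suc i) x)"
    proof
      fix \<pi> assume "\<pi> \<in> {\<pi> \<in> space ?N. \<not> 0 < tprob M (\<pi> i) (\<pi> (Suc i))}"
      then have \<pi>: "\<And>j. \<pi> j \<in> states M" "\<not> 0 < tprob M (\<pi> i) (\<pi> (Suc i))"
        by (auto simp: space_path_measure)
      then have "restrict \<pi> {..Suc i} \<in> ?I"
        using tprob_nonneg[of "\<pi> i" "\<pi> (Suc i)"] by auto
      moreover have "\<pi> \<in> ?cyl (Suc i) (restrict \<pi> {..Suc i})"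
        using \<pi> by auto
      ultimately show "\<pi> \<in> (\<Union>x\<in>?I. ?cyl (Suc i) x)" by blast
    qed
  qed
  have "AE \<pi> in ?N. \<pi> 0 = s \<and> (\<forall>i. 0 < tprob M (\<pi> i) (\<pi> (Suc i)))"
    using 1 2 by (simp add: AE_all_countable)
  then show ?thesis
    by (rule AE_mp) (rule AE_I2, auto simp: paths_from_def space_path_measure[unfolded Pi_def])
qed

end
end
end

theory Submission
  imports Defs
begin

text \<open>This is Wolper's argument that LTL cannot count modulo two. Consider the deterministic chain
  that counts down from \<open>n\<close> to the absorbing state \<open>0\<close>, with \<open>a\<close> holding everywhere but in state
  \<open>1\<close>. The formula \<open>f\<close> says that \<open>a\<close> holds at all even positions of some path, so it holds exactly
  in the even states. A PCTL formula \<open>g\<close>, on the other hand, does not distinguish \<open>k\<close>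
  from \<open>Suc k\<close> once \<open>k \<ge> size g + 2\<close>: on a deterministic chain every event has probability \<open>0\<close> or
  \<open>1\<close>, so until and release obey their one-step expansion laws, and only the next operator
  shifts the point from which \<open>g\<close> is constant.\<close>

text \<open>State \<open>0\<close> is absorbing because subtraction on the naturals truncates.\<close>

definition countdown :: "'ap \<Rightarrow> nat \<Rightarrow> (nat, 'ap) chain" where
  "countdown a n = \<lparr>states = {..n}, tprob = (\<lambda>s t. of_bool (t = s - 1)),
     label = (\<lambda>s. if s = 1 then {} else {a})\<rparr>"

lemma countdown_simps [simp]:
  "states (countdown a n) = {..n}"
  "tprob (countdown a n) s t = of_bool (t = s - 1)"
  "label (countdown a n) s = (if s = 1 then {} else {a})"
  by (simp_all add: countdown_def)

lemma sum_of_bool_eq_singleton: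
  "finite A \<Longrightarrow> (\<Sum>t\<in>A. of_bool (t = u)) = (of_bool (u \<in> A) :: real)"
  by (simp add: of_bool_def)

lemma markov_chain_countdown: "markov_chain (countdown a n)"
  by unfold_locales (auto simp: sum_of_bool_eq_singleton)

lemma next_sem_countdown:
  "finite A \<Longrightarrow> next_sem (countdown a n) c p A = {s. s \<le> n \<and> cmp_holds c (of_bool (s - 1 \<in> A)) p}"
  unfolding next_sem_def countdown_simps by (simp only: sum_of_bool_eq_singleton atMost_iff)

lemma paths_from_countdown:
  assumes "s \<le> n"
  shows "paths_from (countdown a n) s = {\<lambda>i. s - i}"
proof (intro equalityI subsetI)
  fix \<pi> assume "\<pi> \<in> paths_from (countdown a n) s"
  then have "\<pi> 0 = s" and "\<And>i. \<pi> (Suc i) = \<pi> i - 1"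
    by (simp_all add: paths_from_def)
  then have "\<pi> i = s - i" for i
    by (induction i) auto
  then show "\<pi> \<in> {\<lambda>i. s - i}" by auto
qed (use assms in \<open>auto simp: paths_from_def\<close>)

text \<open>The measure is concentrated on paths and the countdown is the only path from
  \<open>s\<close>, so each event on paths is either almost sure or empty.\<close>

lemma path_prob_countdown:
  assumes "s \<le> n"
  shows "path_prob (countdown a n) s \<phi> = of_bool (\<phi> (\<lambda>i. s - i))"
proof -
  interpret markov_chain "countdown a n" by (rule markov_chain_countdown)
  have s: "s \<in> states (countdown a n)" using assms by simp
  interpret P: prob_space "path_measure (countdown a n) s"
    by (rule prob_space_path_measure[OF s])
  have "{\<pi> \<in> paths_from (countdown a n) s. True} \<in> P.events"
    by (rule sets_path_event[OF s]) simp
  then have "P.prob (paths_from (countdown a n) s) = 1"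
    using AE_paths_from[OF s] by (simp add: P.prob_eq_1)
  moreover have "{\<pi> \<in> paths_from (countdown a n) s. \<phi> \<pi>} =
      (if \<phi> (\<lambda>i. s - i) then paths_from (countdown a n) s else {})"
    by (auto simp: paths_from_countdown[OF assms])
  ultimately show ?thesis
    by (simp add: path_prob_def)
qed

lemma path_until_unfold:
  "path_until A B \<pi> \<longleftrightarrow> \<pi> 0 \<in> B \<or> \<pi> 0 \<in> A \<and> path_until A B (\<lambda>i. \<pi> (Suc i))"
proof -
  have "(\<exists>i. P i) \<longleftrightarrow> P 0 \<or> (\<exists>i. P (Suc i))" for P :: "nat \<Rightarrow> bool"
    by (metis not0_implies_Suc)
  from this[of "\<lambda>i. \<pi> i \<in> B \<and> (\<forall>j<i. \<pi> j \<in> A)"] show ?thesis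
    unfolding path_until_def by (auto simp: All_less_Suc2)
qed

lemma path_release_unfold:
  "path_release A B \<pi> \<longleftrightarrow> \<pi> 0 \<in> B \<and> (\<pi> 0 \<in> A \<or> path_release A B (\<lambda>i. \<pi> (Suc i)))"
proof -
  have "(\<forall>j. \<pi> j \<in> B) \<longleftrightarrow> \<pi> 0 \<in> B \<and> (\<forall>j. \<pi> (Suc j) \<in> B)"
    by (metis not0_implies_Suc)
  then show ?thesis
    unfolding path_release_def by (subst path_until_unfold) auto
qed

lemma (in markov_chain) pctl_sem_subset: "pctl_sem M g \<subseteq> states M"
  by (induction g) (auto simp: next_sem_def)

lemma finite_pctl_sem_countdown: "finite (pctl_sem (countdown a n) g)"
  using markov_chain.pctl_sem_subset[OF markov_chain_countdown, of a n g]
  by (auto intro: finite_subset)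

text \<open>The tail of the countdown from \<open>Suc k\<close> is the countdown from
  \<open>k\<close>. Expanding once at \<open>Suc k\<close> and once at \<open>k\<close> tests the
  same memberships, and the second test is absorbed by the first.\<close>

lemma path_until_shift:
  assumes "Suc k \<in> A \<longleftrightarrow> k \<in> A" and "Suc k \<in> B \<longleftrightarrow> k \<in> B"
  shows "path_until A B (\<lambda>i. Suc k - i) \<longleftrightarrow> path_until A B (\<lambda>i. k - i)"
  using assms path_until_unfold[of A B "\<lambda>i. Suc k - i"] path_until_unfold[of A B "\<lambda>i. k - i"]
  by auto

lemma path_release_shift:
  assumes "Suc k \<in> A \<longleftrightarrow> k \<in> A" and "Suc k \<in> B \<longleftrightarrow> k \<in> B"
  shows "path_release A B (\<lambda>i. Suc k - i) \<longleftrightarrow> path_release A B (\<lambda>i. k - i)"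
  using assms path_release_unfold[of A B "\<lambda>i. Suc k - i"] path_release_unfold[of A B "\<lambda>i. k - i"]
  by auto

lemma pctl_sem_countdown_Suc:
  assumes "size g + 2 \<le> k" and "Suc k \<le> n"
  shows "Suc k \<in> pctl_sem (countdown a n) g \<longleftrightarrow> k \<in> pctl_sem (countdown a n) g"
  using assms
proof (induction g arbitrary: k)
  case (CNext c p g)
  \<comment> \<open>The next operator moves the comparison down to \<open>k\<close> and
    \<open>k - 1\<close>; the smaller size of the subformula pays for this. The summand 2 keeps both
    states above state \<open>1\<close> at the atoms.\<close>
  have "Suc (k - 1) \<in> pctl_sem (countdown a n) g \<longleftrightarrow> k - 1 \<in> pctl_sem (countdown a n) g"
    using CNext.prems by (intro CNext.IH) auto
  then show ?case
    using CNext.prems by (simp add: next_sem_countdown finite_pctl_sem_countdown)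
next
  case (CUntil g c p h)
  then show ?case
    by (simp add: path_prob_countdown path_until_shift)
next
  case (CRelease g c p h)
  then show ?case
    by (simp add: path_prob_countdown path_release_shift)
qed auto

lemma pmutl_sem_even_positions_countdown:
  "pmutl_closed_sem (countdown a n) (MNu Z (MAnd (MAtom a) (MNext Greater 0 (MNext Greater 0 (MVar Z)))))
     = {k. k \<le> n \<and> even k}" (is "?E = _")
proof -
  interpret markov_chain "countdown a n" by (rule markov_chain_countdown)
  let ?body = "MAnd (MAtom a) (MNext Greater 0 (MNext Greater 0 (MVar Z)))"
  have body: "pmutl_sem (countdown a n) ?body (e(Z := X)) = {k. k \<le> n \<and> k \<noteq> 1 \<and> k - 2 \<in> X}"
    for e X by (auto simp: next_sem_countdown numeral_2_eq_2)
  have "?E = pmutl_sem (countdown a n) ?body ((\<lambda>_. {})(Z := ?E))"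
    unfolding pmutl_closed_sem_def by (rule pmutl_sem_Nu(2)[symmetric])
  then have unfold: "k \<in> ?E \<longleftrightarrow> k \<le> n \<and> k \<noteq> 1 \<and> k - 2 \<in> ?E" for k
    unfolding body by blast
  \<comment> \<open>At \<open>k = 0\<close> the equation \<open>unfold\<close> is a tautology, as
    \<open>0 - 2 = 0\<close>. State \<open>0\<close> belongs to \<open>?E\<close> because the
    fixpoint is the greatest one and \<open>{0}\<close> is a post-fixpoint.\<close>
  have "{0} \<subseteq> ?E"
    unfolding pmutl_closed_sem_def pmutl_sem.simps(10)
    by (rule gfp_upperbound) (subst body, simp)
  then have "k \<in> ?E \<longleftrightarrow> k \<le> n \<and> even k" for k
  proof (induction k rule: less_induct)
    case (less k)
    consider "k = 0" | "k = 1" | "k \<ge> 2" by linarith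
    then show ?case
    proof cases
      case 3
      then show ?thesis
        using less.IH[of "k - 2"] less.prems unfold[of k] by auto
    qed (use less.prems unfold[of k] in auto)
  qed
  then show ?thesis by blast
qed

theorem theorem6:
  fixes a :: "'ap :: countable" and Z :: "'z :: countable"
    and f :: "('ap, 'z) pmutl"
  assumes f: "f = MNu Z (MAnd (MAtom a) (MNext Greater 0 (MNext Greater 0 (MVar Z))))"
  shows "pmutl_qualitative f \<and>
    \<not> (\<exists>g :: 'ap pctl. pctl_qualitative g \<and>
         (\<forall>M :: (nat, 'ap) chain. markov_chain M \<longrightarrow> pctl_sem M g = pmutl_closed_sem M f))"
proof (intro conjI notI)
  show "pmutl_qualitative f"
    by (simp add: f)
next
  assume "\<exists>g :: 'ap pctl. pctl_qualitative g \<and>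
    (\<forall>M :: (nat, 'ap) chain. markov_chain M \<longrightarrow> pctl_sem M g = pmutl_closed_sem M f)"
  then obtain g :: "'ap pctl" where
    g: "\<And>M :: (nat, 'ap) chain. markov_chain M \<Longrightarrow> pctl_sem M g = pmutl_closed_sem M f"
    by blast
  let ?k = "size g + 2"
  \<comment> \<open>This chain is just long enough to contain both \<open>?k\<close> and
    \<open>Suc ?k\<close>, which differ in parity but not in membership in \<open>g\<close>.\<close>
  have "pctl_sem (countdown a (Suc ?k)) g = {k. k \<le> Suc ?k \<and> even k}"
    unfolding g[OF markov_chain_countdown] f by (rule pmutl_sem_even_positions_countdown)
  then show False
    using pctl_sem_countdown_Suc[of g ?k "Suc ?k" a] by simp
qed

end
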